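(* Arbitrarily small nonzero magic in any one of the encoding states ensures quantum advantage in all (2-level) $N\mapsto1$ random access code tasks for $N\in\mathbb{N}$, even when all other encoding states are restricted to the stabilizer set $\mathrm{St}_2$ and all decodings are limited to Clifford operations.
   Context: $N\mapsto 1$ random access code (RAC) task, 2-level: Alice receives a uniformly random string $\mathbf{x}=x_1\cdots x_N\in\{0,1\}^N$, Bob receives a uniformly random $y\in\{1,\dots,N\}$, Alice sends one 2-level system to Bob, and Bob must output $b=x_y$. The figure of merit is the average success probability $P_{\mathrm{succ}}=\frac{1}{N2^N}\sum_{\mathbf{x},y}p(b=x_y|\mathbf{x},y)$. In a quantum protocol Alice encodes $\mathbf{x}$ in a qubit state $\psi_{\mathbf{x}}$ (the encoding states) and Bob, depending on $y$, measures the received qubit to obtain $b$. Quantum advantage means that $P_{\mathrm{succ}}$ strictly exceeds the optimal success probability achievable when Alice instead sends one classical bit (shared randomness between Alice and Bob being allowed). $\mathrm{St}_2$ is the set of qubit stabilizer states: the convex hull of the states $U|0\rangle\langle0|U^\dagger$ with $U$ in the single-qubit Clifford group (the unitaries that map every Pauli operator to a Pauli operator, up to phase, under conjugation); equivalently, the convex hull of the six eigenprojectors of the Pauli operators $\sigma_x,\sigma_y,\sigma_z$. A state outside $\mathrm{St}_2$ is called a non-stabilizer (magic) state. Decodings limited to Clifford operations: Bob's measurements are stabilizer measurements, i.e. those obtained from Clifford rotations and computational-basis measurements, such as projective measurements in the eigenbases of $\sigma_x,\sigma_y,\sigma_z$, chosen depending on $y$. The amount of magic of a state may be quantified by any faithful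 measure (one that vanishes exactly on $\mathrm{St}_2$). The statement is to be read with care: a single magic encoding state can lead to an advantage, but (as is noted for the $2\mapsto1$ and $3\mapsto1$ tasks) not all non-stabilizer states necessarily yield such an advantage.
   Formalization: Proved for N ≥ 2 (for N = 1 one classical bit already succeeds with certainty, so no advantage exists) and for continuous faithful measures of magic (a discontinuous one, such as the indicator of non-stabilizer states, may take no arbitrarily small nonzero values). *)

theory Defs
  imports "HOL-Probability.Probability"
begin

section \<open>Qubits, the Clifford group and the stabilizer set\<close>

definition adjoint_mat :: "complex^2^2 \<Rightarrow> complex^2^2" where
  "adjoint_mat A = map_matrix cnj (transpose A)"

definition unitary_mat :: "complex^2^2 \<Rightarrow> bool" where
  "unitary_mat U \<longleftrightarrow> adjoint_mat U ** U = mat 1 \<and> U ** adjoint_mat U = mat 1"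

definition qubit_states :: "(complex^2^2) set" where
  "qubit_states = {\<rho>. adjoint_mat \<rho> = \<rho> \<and>
     (\<forall>v :: complex^2. 0 \<le> Re (\<Sum>i\<in>UNIV. cnj (v $ i) * (\<rho> *v v) $ i)) \<and>
     trace \<rho> = 1}"

definition pauli_x :: "complex^2^2" where
  "pauli_x = vector [vector [0, 1], vector [1, 0]]"

definition pauli_y :: "complex^2^2" where
  "pauli_y = vector [vector [0, - \<i>], vector [\<i>, 0]]"

definition pauli_z :: "complex^2^2" where
  "pauli_z = vector [vector [1, 0], vector [0, -1]]"

definition paulis :: "(complex^2^2) set" where
  "paulis = {mat 1, pauli_x, pauli_y, pauli_z}"

definition clifford_group :: "(complex^2^2) set" where
  "clifford_group = {U. unitary_mat U \<and>
     (\<forall>P\<in>paulis. \<exists>Q\<in>paulis. \<exists>c :: complex. norm c = 1 \<and>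
        U ** P ** adjoint_mat U = (\<chi> i j. c * Q $ i $ j))}"

text \<open>Projector onto a computational basis vector; bits are Booleans, with False for 0.\<close>

definition basis_proj :: "bool \<Rightarrow> complex^2^2" where
  "basis_proj b = (if b then vector [vector [0, 0], vector [0, 1]]
                        else vector [vector [1, 0], vector [0, 0]])"

definition stabilizer_states :: "(complex^2^2) set" where
  "stabilizer_states =
     convex hull ((\<lambda>U. U ** basis_proj False ** adjoint_mat U) ` clifford_group)"

text \<open>A stabilizer measurement applies a Clifford unitary \<open>U\<close> and then measures in the
  computational basis, so its effects are the projectors below.\<close>

definition stabilizer_measurement :: "(bool \<Rightarrow> complex^2^2) \<Rightarrow> bool" where
  "stabilizer_measurement E \<longleftrightarrow>
     (\<exists>U\<in>clifford_group. \<forall>b. E b = adjoint_mat U ** basis_proj b ** U)"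

definition faithful_magic_measure :: "(complex^2^2 \<Rightarrow> real) \<Rightarrow> bool" where
  "faithful_magic_measure M \<longleftrightarrow>
     (\<forall>\<rho>\<in>qubit_states. 0 \<le> M \<rho> \<and> (M \<rho> = 0 \<longleftrightarrow> \<rho> \<in> stabilizer_states))"


section \<open>Random access codes\<close>

text \<open>A behaviour \<open>p b x y\<close> is the probability of output \<open>b\<close> given Alice's string \<open>x\<close> and
  Bob's index \<open>y\<close>. Strings are Boolean lists of length \<open>N\<close>, and the indices
  \<open>1, \<dots>, N\<close> are shifted to \<open>0, \<dots>, N - 1\<close>.\<close>

type_synonym behaviour = "bool \<Rightarrow> bool list \<Rightarrow> nat \<Rightarrow> real"

definition succ_prob :: "nat \<Rightarrow> behaviour \<Rightarrow> real" where
  "succ_prob N p =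
     (\<Sum>x\<in>{x. length x = N}. \<Sum>y<N. p (x ! y) x y) / (real N * 2 ^ N)"

definition qubit_behaviour ::
  "(bool list \<Rightarrow> complex^2^2) \<Rightarrow> (nat \<Rightarrow> bool \<Rightarrow> complex^2^2) \<Rightarrow> behaviour" where
  "qubit_behaviour \<psi> E = (\<lambda>b x y. Re (trace (\<psi> x ** E y b)))"

text \<open>One classical bit \<open>m\<close> of communication. The shared randomness \<open>l\<close> has an arbitrary
  Borel distribution on the reals (which covers all discrete distributions); given \<open>l\<close>,
  the encoder and the decoder may in addition randomize locally.\<close>

definition classical_behaviours :: "behaviour set" where
  "classical_behaviours = {p. \<exists>(\<mu> :: real measure)
       (enc :: real \<Rightarrow> bool list \<Rightarrow> bool pmf) (dec :: real \<Rightarrow> bool \<Rightarrow> nat \<Rightarrow> bool pmf).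
     prob_space \<mu> \<and> sets \<mu> = sets borel \<and>
     (\<forall>x m. (\<lambda>l. pmf (enc l x) m) \<in> borel_measurable \<mu>) \<and>
     (\<forall>m y b. (\<lambda>l. pmf (dec l m y) b) \<in> borel_measurable \<mu>) \<and>
     p = (\<lambda>b x y. \<integral>l. (\<Sum>m\<in>UNIV. pmf (enc l x) m * pmf (dec l m y) b) \<partial>\<mu>)}"

definition classical_optimum :: "nat \<Rightarrow> real" where
  "classical_optimum N = (SUP p\<in>classical_behaviours. succ_prob N p)"

definition quantum_advantage :: "nat \<Rightarrow> behaviour \<Rightarrow> bool" where
  "quantum_advantage N p \<longleftrightarrow> classical_optimum N < succ_prob N p"

end

theory Submission
  imports Defs
begin

text \<open>Bob measures \<open>\<sigma>\<^sub>x\<close> for one index and \<open>\<sigma>\<^sub>z\<close> for all others, flipping outcomes according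
  to \<open>x0\<close>. If \<open>a\<close> and \<open>b = \<plusminus>1\<close> are the signed sums over the two groups of indices, the best
  stabilizer encoding of a word has value \<open>max \<bar>a\<bar> 1 = (\<bar>a + 1\<bar> + \<bar>a - 1\<bar>) / 2\<close>, the mean of \<open>\<bar>a + b\<bar>\<close>
  over the sign \<open>b\<close>. So stabilizer encodings exactly reach the classical value of majority encoding,
  which is optimal since \<open>\<bar>A + e\<bar> + \<bar>A - e\<bar>\<close> is monotone in \<open>\<bar>e\<bar>\<close>. For \<open>x0\<close> itself
  \<open>a = N - 1\<close> and \<open>b = 1\<close>, so \<open>(a, b)\<close> is not along an axis; moving its encoding from the pole
  to the Bloch vector \<open>(t, 0, 1 - t\<^sup>2)\<close> leaves the octahedron and gains \<open>t - a t\<^sup>2 > 0\<close>.\<close>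

section \<open>Signed sums over all binary words\<close>

definition sgb :: "bool \<Rightarrow> real" where
  "sgb b = (if b then -1 else 1)"

definition words :: "nat \<Rightarrow> bool list set" where
  "words n = {x. length x = n}"

lemma sgb_simps [simp]: "sgb True = -1" "sgb False = 1" "\<bar>sgb b\<bar> = 1" "sgb b * sgb b = 1"
  by (auto simp: sgb_def)

lemma sgb_xor: "sgb (b = (\<not> c)) = sgb b * sgb c"
  by (auto simp: sgb_def)

lemma finite_words [simp]: "finite (words n)"
  using finite_lists_length_eq[of "UNIV :: bool set" n] by (simp add: words_def)

lemma card_words: "card (words n) = 2 ^ n"
  using card_lists_length_eq[of "UNIV :: bool set" n] by (simp add: words_def)

lemma sum_words_Suc:
  fixes f :: "bool list \<Rightarrow> real"
  shows "(\<Sum>x\<in>words (Suc n). f x) = (\<Sum>x\<in>words n. f (False # x) + f (True # x))"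
proof -
  have eq: "words (Suc n) = (#) False ` words n \<union> (#) True ` words n"
    by (auto simp: words_def length_Suc_conv image_iff)
  show ?thesis unfolding eq
    by (subst sum.union_disjoint) (auto simp: sum.reindex sum.distrib)
qed

text \<open>Words that differ only in one bit contribute opposite terms for that bit.\<close>

lemma sum_words_sgb:
  "(\<Sum>x\<in>words n. \<Sum>y<n. sgb (x ! y) * c y) = 0"
proof (induction n arbitrary: c)
  case (Suc n)
  have "(\<Sum>x\<in>words (Suc n). \<Sum>y<Suc n. sgb (x ! y) * c y)
      = 2 * (\<Sum>x\<in>words n. \<Sum>y<n. sgb (x ! y) * c (Suc y))"
    by (simp add: sum_words_Suc sum.lessThan_Suc_shift sum_distrib_left del: sum.lessThan_Suc)
  then show ?case using Suc.IH by simp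
qed simp

text \<open>Summing over the first bit gives
  \<open>\<bar>A + c 0\<bar> + \<bar>A - c 0\<bar>\<close>, so coefficients can be enlarged one at a
  time. The offset \<open>a\<close> is general so that the induction can absorb the head coefficient
  into it.\<close>

lemma sum_words_abs_mono:
  assumes "\<And>y. y < n \<Longrightarrow> \<bar>c y\<bar> \<le> \<bar>d y\<bar>"
  shows "(\<Sum>x\<in>words n. \<bar>a + (\<Sum>y<n. sgb (x ! y) * c y)\<bar>)
       \<le> (\<Sum>x\<in>words n. \<bar>a + (\<Sum>y<n. sgb (x ! y) * d y)\<bar>)"
  using assms
proof (induction n arbitrary: a c d)
  case (Suc n)
  define S where "S x = (\<Sum>y<n. sgb (x ! y) * c (Suc y))" for x
  have head: "\<bar>c 0\<bar> \<le> \<bar>d 0\<bar>" using Suc.prems by simp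
  have "(\<Sum>x\<in>words (Suc n). \<bar>a + (\<Sum>y<Suc n. sgb (x ! y) * c y)\<bar>)
      = (\<Sum>x\<in>words n. \<bar>a + c 0 + S x\<bar> + \<bar>a - c 0 + S x\<bar>)"
    by (simp add: sum_words_Suc sum.lessThan_Suc_shift S_def algebra_simps del: sum.lessThan_Suc)
  also have "\<dots> \<le> (\<Sum>x\<in>words n. \<bar>a + d 0 + S x\<bar> + \<bar>a - d 0 + S x\<bar>)"
    using head by (intro sum_mono) linarith
  also have "\<dots> = (\<Sum>x\<in>words n. \<bar>a + d 0 + S x\<bar>) + (\<Sum>x\<in>words n. \<bar>a - d 0 + S x\<bar>)"
    by (rule sum.distrib)
  also have "\<dots> \<le> (\<Sum>x\<in>words n. \<bar>a + d 0 + (\<Sum>y<n. sgb (x ! y) * d (Suc y))\<bar>)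
                 + (\<Sum>x\<in>words n. \<bar>a - d 0 + (\<Sum>y<n. sgb (x ! y) * d (Suc y))\<bar>)"
    unfolding S_def using Suc.prems by (intro add_mono Suc.IH) auto
  also have "\<dots> = (\<Sum>x\<in>words (Suc n). \<bar>a + (\<Sum>y<Suc n. sgb (x ! y) * d y)\<bar>)"
    by (simp add: sum_words_Suc sum.lessThan_Suc_shift sum.distrib algebra_simps del: sum.lessThan_Suc)
  finally show ?case .
qed simp

text \<open>The left side ignores bit 0, so each tail counts twice there; on the right its two
  extensions carry the two signs of \<open>e 0\<close>.\<close>

lemma sum_words_max:
  assumes "\<bar>e 0\<bar> = 1"
  shows "(\<Sum>x\<in>words (Suc n). max \<bar>\<Sum>y<n. sgb (x ! Suc y) * e (Suc y)\<bar> 1)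
       = (\<Sum>x\<in>words (Suc n). \<bar>\<Sum>y<Suc n. sgb (x ! y) * e y\<bar>)"
proof -
  have "2 * max \<bar>A\<bar> 1 = \<bar>e 0 + A\<bar> + \<bar>A - e 0\<bar>" for A :: real
    using assms by (auto simp: max_def)
  then show ?thesis
    by (simp add: sum_words_Suc sum.lessThan_Suc_shift del: sum.lessThan_Suc)
qed

text \<open>Total of right minus wrong guesses when Alice sends the majority bit and Bob always
  outputs it.\<close>

definition majority_sum :: "nat \<Rightarrow> real" where
  "majority_sum n = (\<Sum>x\<in>words n. \<bar>\<Sum>y<n. sgb (x ! y)\<bar>)"

text \<open>Monotonicity applied in both directions replaces relabelling the words by a fixed
  mask.\<close>

lemma sum_words_abs_signs:
  assumes "\<And>y. y < n \<Longrightarrow> \<bar>e y\<bar> = 1"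
  shows "(\<Sum>x\<in>words n. \<bar>\<Sum>y<n. sgb (x ! y) * e y\<bar>) = majority_sum n"
  using sum_words_abs_mono[of n e "\<lambda>_. 1" 0] sum_words_abs_mono[of n "\<lambda>_. 1" e 0] assms
  by (simp add: majority_sum_def)


section \<open>The classical bound\<close>

lemma pmf_bool_sum: "pmf (p :: bool pmf) True + pmf p False = 1"
  using sum_pmf_eq_1[of UNIV p, OF _ subset_UNIV] by (simp add: UNIV_bool add.commute)

text \<open>Alice does best by sending the message with the larger \<open>T m x\<close>, and a
  maximum is half the sum plus half the distance. The sums cancel over all words; the distances have
  coefficients bounded by 1, so majority decoding dominates.\<close>

lemma classical_sum_le:
  fixes enc :: "bool list \<Rightarrow> bool pmf" and dec :: "bool \<Rightarrow> nat \<Rightarrow> bool pmf"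
  shows "(\<Sum>x\<in>words n. \<Sum>y<n. \<Sum>m\<in>UNIV. pmf (enc x) m * pmf (dec m y) (x ! y))
       \<le> (real n * 2 ^ n + majority_sum n) / 2"
proof -
  \<comment> \<open>\<open>D\<close> is Bob's bias towards \<open>False\<close>;
    \<open>T m x\<close> is then his expected number of right minus wrong guesses on message
    \<open>m\<close>.\<close>
  define D where "D m y = pmf (dec m y) False - pmf (dec m y) True" for m y
  define T where "T m x = (\<Sum>y<n. sgb (x ! y) * D m y)" for m x
  have dec_eq: "pmf (dec m y) b = (1 + sgb b * D m y) / 2" for m y b
    using pmf_bool_sum[of "dec m y"] by (cases b) (auto simp: D_def)
  have D_bound: "\<bar>D m y\<bar> \<le> 1" for m y
    using pmf_bool_sum[of "dec m y"] pmf_nonneg[of "dec m y" True] pmf_nonneg[of "dec m y" False]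
    unfolding D_def by linarith
  have word: "(\<Sum>y<n. \<Sum>m\<in>UNIV. pmf (enc x) m * pmf (dec m y) (x ! y))
      \<le> n / 2 + (T False x + T True x) / 4 + \<bar>T False x - T True x\<bar> / 4" for x
  proof -
    define w where "w = pmf (enc x) True"
    have w: "0 \<le> w" "w \<le> 1" by (auto simp: w_def pmf_le_1)
    have enc_False: "pmf (enc x) False = 1 - w"
      using pmf_bool_sum[of "enc x"] by (simp add: w_def)
    have "(\<Sum>y<n. \<Sum>m\<in>UNIV. pmf (enc x) m * pmf (dec m y) (x ! y))
        = (\<Sum>y<n. 1 / 2 + (w / 2 * (sgb (x ! y) * D True y)
              + (1 - w) / 2 * (sgb (x ! y) * D False y)))"
      by (intro sum.cong) (simp_all add: UNIV_bool dec_eq enc_False w_def[symmetric], simp add: field_simps)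
    also have "\<dots> = n / 2 + (w / 2 * T True x + (1 - w) / 2 * T False x)"
      by (simp add: T_def sum.distrib sum_distrib_left)
    also have "\<dots> \<le> n / 2 + (T False x + T True x) / 4 + \<bar>T False x - T True x\<bar> / 4"
    proof -
      \<comment> \<open>The mixture with weight \<open>w\<close> deviates from the midpoint by at
        most half the distance.\<close>
      have "(1 - 2 * w) * (T False x - T True x) \<le> \<bar>1 - 2 * w\<bar> * \<bar>T False x - T True x\<bar>"
        unfolding abs_mult[symmetric] by (rule abs_ge_self)
      also have "\<dots> \<le> \<bar>T False x - T True x\<bar>"
        using w by (intro mult_left_le_one_le) auto
      finally show ?thesis by (simp add: field_simps)
    qed
    finally show ?thesis .
  qed
  have diff: "T False x - T True x = 2 * (\<Sum>y<n. sgb (x ! y) * ((D False y - D True y) / 2))" for x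
    unfolding T_def sum_distrib_left sum_subtractf[symmetric]
    by (intro sum.cong refl) (simp add: field_simps)
  have "(\<Sum>x\<in>words n. \<Sum>y<n. \<Sum>m\<in>UNIV. pmf (enc x) m * pmf (dec m y) (x ! y))
     \<le> (\<Sum>x\<in>words n. n / 2 + (T False x + T True x) / 4 + \<bar>T False x - T True x\<bar> / 4)"
    by (intro sum_mono word)
  also have "\<dots> = real n * 2 ^ n / 2
      + ((\<Sum>x\<in>words n. T False x) + (\<Sum>x\<in>words n. T True x)) / 4
      + (\<Sum>x\<in>words n. \<bar>T False x - T True x\<bar>) / 4"
    by (simp add: sum.distrib sum_divide_distrib card_words add_divide_distrib)
  also have "\<dots> = real n * 2 ^ n / 2
      + (\<Sum>x\<in>words n. \<bar>\<Sum>y<n. sgb (x ! y) * ((D False y - D True y) / 2)\<bar>) / 2"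
    unfolding diff by (simp add: T_def sum_words_sgb abs_mult sum_distrib_left[symmetric])
  also have "\<dots> \<le> real n * 2 ^ n / 2 + majority_sum n / 2"
  proof -
    have "\<bar>(D False y - D True y) / 2\<bar> \<le> \<bar>1\<bar>" for y
      using D_bound[of False y] D_bound[of True y] by (simp add: abs_le_iff)
    from sum_words_abs_mono[of n "\<lambda>y. (D False y - D True y) / 2" "\<lambda>_. 1" 0, OF this]
    show ?thesis by (simp add: majority_sum_def)
  qed
  finally show ?thesis by (simp add: add_divide_distrib)
qed

text \<open>The bound is uniform in the shared randomness \<open>l\<close>, so it survives
  averaging.\<close>

lemma classical_succ_prob_le:
  assumes "p \<in> classical_behaviours"
  shows "succ_prob n p \<le> (real n * 2 ^ n + majority_sum n) / 2 / (real n * 2 ^ n)"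
proof -
  from assms obtain \<mu> :: "real measure" and enc :: "real \<Rightarrow> bool list \<Rightarrow> bool pmf"
    and dec :: "real \<Rightarrow> bool \<Rightarrow> nat \<Rightarrow> bool pmf" where
    \<mu>: "prob_space \<mu>"
    and [measurable]: "\<And>x m. (\<lambda>l. pmf (enc l x) m) \<in> borel_measurable \<mu>"
      "\<And>m y b. (\<lambda>l. pmf (dec l m y) b) \<in> borel_measurable \<mu>"
    and p: "p = (\<lambda>b x y. \<integral>l. (\<Sum>m\<in>UNIV. pmf (enc l x) m * pmf (dec l m y) b) \<partial>\<mu>)"
    unfolding classical_behaviours_def by blast
  interpret prob_space \<mu> by (rule \<mu>)
  define f where "f x y l = (\<Sum>m\<in>UNIV. pmf (enc l x) m * pmf (dec l m y) (x ! y))" for x y l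
  have int: "integrable \<mu> (f x y)" for x y
    unfolding f_def
    by (intro Bochner_Integration.integrable_sum integrable_const_bound[where B = 1])
       (auto intro!: mult_le_one simp: pmf_le_1)
  have "(\<Sum>x\<in>words n. \<Sum>y<n. p (x ! y) x y) = (\<integral>l. (\<Sum>x\<in>words n. \<Sum>y<n. f x y l) \<partial>\<mu>)"
    by (simp add: p f_def[symmetric] int)
  also have "\<dots> \<le> (real n * 2 ^ n + majority_sum n) / 2"
    by (intro integral_le_const Bochner_Integration.integrable_sum int AE_I2)
       (simp only: f_def classical_sum_le)
  finally show ?thesis
    unfolding succ_prob_def words_def by (intro divide_right_mono) auto
qed

lemma classical_behaviours_nonempty: "classical_behaviours \<noteq> {}"
proof -
  have "(\<lambda>b x y. \<integral>l. (\<Sum>m\<in>UNIV. pmf (return_pmf False) m * pmf (return_pmf False) b) \<partial>return borel (0::real))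
      \<in> classical_behaviours"
    unfolding classical_behaviours_def mem_Collect_eq
    by (intro exI[of _ "return borel 0"] exI[of _ "\<lambda>_ _. return_pmf False"]
        exI[of _ "\<lambda>_ _ _. return_pmf False"]) (auto intro: prob_space_return)
  then show ?thesis by blast
qed

text \<open>An upper bound suffices: exceeding it strictly already proves the advantage.\<close>

lemma classical_optimum_le:
  "classical_optimum n \<le> (real n * 2 ^ n + majority_sum n) / 2 / (real n * 2 ^ n)"
  unfolding classical_optimum_def
  using classical_behaviours_nonempty classical_succ_prob_le by (intro cSUP_least) auto


section \<open>States and effects in the x-z plane of the Bloch ball\<close>

text \<open>Bloch vector \<open>(s, 0, r)\<close>: the z-component comes first. With a unit vector
  it also serves as a measurement effect.\<close>

definition bloch :: "real \<Rightarrow> real \<Rightarrow> complex^2^2" where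
  "bloch r s = vector [vector [of_real ((1 + r) / 2), of_real (s / 2)],
                       vector [of_real (s / 2), of_real ((1 - r) / 2)]]"

lemmas mat2_simps = vec_eq_iff forall_2 sum_2 matrix_matrix_mult_def matrix_vector_mult_def
  adjoint_mat_def transpose_def map_matrix_def mat_def

lemma trace_bloch_mult: "Re (trace (bloch r s ** bloch r' s')) = (1 + r * r' + s * s') / 2"
  by (simp add: trace_def bloch_def mat2_simps field_simps)

lemma bloch_qubit_state:
  assumes "0 \<le> t" "t \<le> 1"
  shows "bloch (1 - t\<^sup>2) t \<in> qubit_states"
proof -
  have "0 \<le> Re (\<Sum>i\<in>UNIV. cnj (v $ i) * (bloch (1 - t\<^sup>2) t *v v) $ i)" for v :: "complex^2"
  proof -
    define a b c d where "a = Re (v $ 1)" "b = Im (v $ 1)" "c = Re (v $ 2)" "d = Im (v $ 2)"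
    \<comment> \<open>Completing the square: twice the form is \<open>\<bar>v1 + t v2\<bar>\<^sup>2
      + (1 - t\<^sup>2) \<bar>v1\<bar>\<^sup>2\<close>.\<close>
    have "Re (\<Sum>i\<in>UNIV. cnj (v $ i) * (bloch (1 - t\<^sup>2) t *v v) $ i)
        = ((a + t * c)\<^sup>2 + (b + t * d)\<^sup>2 + (1 - t\<^sup>2) * (a\<^sup>2 + b\<^sup>2)) / 2"
      unfolding a_b_c_d_def
      by (simp add: bloch_def mat2_simps power2_eq_square field_simps)
    also have "\<dots> \<ge> 0" using assms by (simp add: power_le_one)
    finally show ?thesis .
  qed
  moreover have "adjoint_mat (bloch (1 - t\<^sup>2) t) = bloch (1 - t\<^sup>2) t"
    by (simp add: bloch_def mat2_simps)
  moreover have "trace (bloch (1 - t\<^sup>2) t) = 1"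
    by (simp add: trace_def bloch_def sum_2 field_simps)
  ultimately show ?thesis
    unfolding qubit_states_def by blast
qed

section \<open>Clifford unitaries for the two measurement bases, with outcome flips built in\<close>

definition flip_z :: "bool \<Rightarrow> complex^2^2" where
  "flip_z f = (if f then pauli_x else mat 1)"

text \<open>The Hadamard matrix, conjugated by \<open>pauli_z\<close> if \<open>f\<close>
  holds.\<close>

definition flip_x :: "bool \<Rightarrow> complex^2^2" where
  "flip_x f = vector [vector [of_real (1 / sqrt 2), of_real (sgb f / sqrt 2)],
                      vector [of_real (sgb f / sqrt 2), of_real (- 1 / sqrt 2)]]"

lemma clifford_groupI:
  assumes "unitary_mat U"
    and "\<And>P. P \<in> paulis \<Longrightarrow> \<exists>Q\<in>paulis. U ** P ** adjoint_mat U = Q \<or> U ** P ** adjoint_mat U = - Q"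
  shows "U \<in> clifford_group"
proof -
  have "\<exists>Q\<in>paulis. \<exists>c. norm c = 1 \<and> U ** P ** adjoint_mat U = (\<chi> i j. c * Q $ i $ j)"
    if P: "P \<in> paulis" for P
  proof -
    obtain Q where Q: "Q \<in> paulis" "U ** P ** adjoint_mat U = Q \<or> U ** P ** adjoint_mat U = - Q"
      using assms(2)[OF P] by blast
    then have "\<exists>c. norm c = 1 \<and> U ** P ** adjoint_mat U = (\<chi> i j. c * Q $ i $ j)"
      by (elim disjE; intro exI[of _ 1] exI[of _ "-1"]) (simp_all add: vec_eq_iff)
    with Q(1) show ?thesis by blast
  qed
  with assms(1) show ?thesis by (simp add: clifford_group_def)
qed

lemma flip_z_clifford: "flip_z f \<in> clifford_group"
proof (rule clifford_groupI)
  show "unitary_mat (flip_z f)"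
    by (cases f) (auto simp: unitary_mat_def flip_z_def pauli_x_def mat2_simps)
  fix P assume "P \<in> paulis"
  moreover have "flip_z f ** P ** adjoint_mat (flip_z f) = P \<or>
      flip_z f ** P ** adjoint_mat (flip_z f) = - P" if "P \<in> paulis"
    using that
    by (cases f) (auto simp: paulis_def flip_z_def pauli_x_def pauli_y_def pauli_z_def mat2_simps)
  ultimately show "\<exists>Q\<in>paulis. flip_z f ** P ** adjoint_mat (flip_z f) = Q \<or>
      flip_z f ** P ** adjoint_mat (flip_z f) = - Q" by blast
qed

lemma flip_x_clifford: "flip_x f \<in> clifford_group"
proof (rule clifford_groupI)
  show "unitary_mat (flip_x f)"
    by (cases f) (auto simp: unitary_mat_def flip_x_def mat2_simps complex_eq_iff)
  have "flip_x f ** mat 1 ** adjoint_mat (flip_x f) = mat 1"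
    by (cases f) (auto simp: flip_x_def mat2_simps complex_eq_iff)
  moreover have "flip_x f ** pauli_x ** adjoint_mat (flip_x f) = (if f then - pauli_z else pauli_z)"
    by (cases f) (auto simp: flip_x_def pauli_x_def pauli_z_def mat2_simps complex_eq_iff)
  moreover have "flip_x f ** pauli_y ** adjoint_mat (flip_x f) = - pauli_y"
    by (cases f) (auto simp: flip_x_def pauli_y_def mat2_simps complex_eq_iff)
  moreover have "flip_x f ** pauli_z ** adjoint_mat (flip_x f) = (if f then - pauli_x else pauli_x)"
    by (cases f) (auto simp: flip_x_def pauli_x_def pauli_z_def mat2_simps complex_eq_iff)
  ultimately show "\<exists>Q\<in>paulis. flip_x f ** P ** adjoint_mat (flip_x f) = Q \<or>
      flip_x f ** P ** adjoint_mat (flip_x f) = - Q" if "P \<in> paulis" for P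
    using that by (auto simp: paulis_def split: if_splits)
qed

lemma flip_z_conj: "flip_z f ** basis_proj b ** adjoint_mat (flip_z f) = bloch (sgb (b \<noteq> f)) 0"
  "adjoint_mat (flip_z f) ** basis_proj b ** flip_z f = bloch (sgb (b \<noteq> f)) 0"
  by (cases b; cases f; simp add: basis_proj_def flip_z_def pauli_x_def bloch_def mat2_simps)+

lemma flip_x_conj: "flip_x f ** basis_proj b ** adjoint_mat (flip_x f) = bloch 0 (sgb (b \<noteq> f))"
  "adjoint_mat (flip_x f) ** basis_proj b ** flip_x f = bloch 0 (sgb (b \<noteq> f))"
  by (cases b; cases f; simp add: basis_proj_def flip_x_def bloch_def mat2_simps complex_eq_iff)+

lemma bloch_stabilizer_states: "bloch (sgb f) 0 \<in> stabilizer_states" "bloch 0 (sgb f) \<in> stabilizer_states"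
  unfolding stabilizer_states_def
  using flip_z_conj(1)[of f False] flip_x_conj(1)[of f False] flip_z_clifford[of f] flip_x_clifford[of f]
  by (auto intro!: hull_inc image_eqI simp: eq_commute)

lemma bloch_stabilizer_measurement:
  "stabilizer_measurement (\<lambda>b. bloch (sgb (b \<noteq> f)) 0)" "stabilizer_measurement (\<lambda>b. bloch 0 (sgb (b \<noteq> f)))"
  unfolding stabilizer_measurement_def
  using flip_z_conj(2)[of f] flip_x_conj(2)[of f] flip_z_clifford[of f] flip_x_clifford[of f]
  by metis+

section \<open>Separating magic states from the stabilizer set\<close>

lemma matrix_add_rdistrib: "((A :: ('a::semiring_1)^'n^'m) + B) ** C = A ** C + B ** C"
  by (simp add: vec_eq_iff matrix_matrix_mult_def distrib_right sum.distrib)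

text \<open>The half-space \<open>x + z \<le> 1\<close> of Bloch vectors supports the octahedron
  along an edge. The functional is linear, so only the generators of the hull matter.\<close>

lemma stabilizer_states_bound:
  assumes "\<rho> \<in> stabilizer_states"
  shows "Re (trace (\<rho> ** (pauli_x + pauli_z))) \<le> 1"
proof -
  define L :: "complex^2^2 \<Rightarrow> real" where "L \<rho> = Re (trace (\<rho> ** (pauli_x + pauli_z)))" for \<rho>
  have "linear L"
    by (intro linearI)
       (simp_all add: L_def trace_def mat2_simps pauli_x_def pauli_z_def algebra_simps)
  then have "convex (L -` {..1})"
    by (rule convex_linear_vimage) simp
  moreover have "L (U ** basis_proj False ** adjoint_mat U) \<le> 1" if U: "U \<in> clifford_group" for U
  proof -
    from U have "pauli_z \<in> paulis" and unit: "U ** adjoint_mat U = mat 1"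
      by (auto simp: clifford_group_def unitary_mat_def paulis_def)
    with U obtain Q c where Q: "Q \<in> paulis" and c: "norm c = 1"
      and eq: "U ** pauli_z ** adjoint_mat U = (\<chi> i j. c * Q $ i $ j)"
      unfolding clifford_group_def by blast
    \<comment> \<open>This reduces the orbit of the pole to the image of \<open>pauli_z\<close>, a
      phase times a Pauli matrix.\<close>
    have "basis_proj False = (1 / 2) *\<^sub>R (mat 1 + pauli_z)"
      by (simp add: basis_proj_def pauli_z_def mat2_simps complex_eq_iff)
    then have "U ** basis_proj False ** adjoint_mat U
        = (1 / 2) *\<^sub>R (U ** adjoint_mat U + U ** pauli_z ** adjoint_mat U)"
      by (simp add: matrix_add_ldistrib matrix_add_rdistrib scalar_matrix_assoc[symmetric]
          matrix_scalar_ac scaleR_add_right)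
    then have "L (U ** basis_proj False ** adjoint_mat U)
        = (L (mat 1) + L (\<chi> i j. c * Q $ i $ j)) / 2"
      by (simp add: unit eq linear_scale[OF \<open>linear L\<close>] linear_add[OF \<open>linear L\<close>])
    also have "L (mat 1) = 0"
      by (simp add: L_def trace_def mat2_simps pauli_x_def pauli_z_def)
    \<comment> \<open>\<open>L\<close> gives \<open>2 * Re c\<close> for \<open>pauli_x\<close> and
      \<open>pauli_z\<close>, and 0 for the other two.\<close>
    also have "L (\<chi> i j. c * Q $ i $ j) \<le> 2"
      using Q abs_Re_le_cmod[of c] c
      by (auto simp: paulis_def L_def trace_def mat2_simps pauli_x_def pauli_y_def pauli_z_def)
    finally show ?thesis by simp
  qed
  ultimately have "stabilizer_states \<subseteq> L -` {..1}"
    unfolding stabilizer_states_def by (intro hull_minimal) auto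
  with assms show ?thesis by (auto simp: L_def)
qed

lemma bloch_not_stabilizer:
  assumes "1 < r + s"
  shows "bloch r s \<notin> stabilizer_states"
proof -
  have "Re (trace (bloch r s ** (pauli_x + pauli_z))) = r + s"
    by (simp add: bloch_def pauli_x_def pauli_z_def trace_def mat2_simps field_simps)
  with assms stabilizer_states_bound[of "bloch r s"] show ?thesis by auto
qed

text \<open>The curve starts at a stabilizer pole, where \<open>M\<close> vanishes, so continuity
  keeps \<open>M\<close> small nearby; it is positive because \<open>1 - t\<^sup>2 + t > 1\<close>
  for \<open>0 < t < 1\<close>.\<close>

lemma magic_bloch:
  assumes "faithful_magic_measure M" "continuous_on qubit_states M" "\<epsilon> > 0" "a > 0"
  obtains t where "0 < t" "t < 1" "t < a" "0 < M (bloch (1 - t\<^sup>2) t)" "M (bloch (1 - t\<^sup>2) t) < \<epsilon>"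
proof -
  define g where "g t = bloch (1 - t\<^sup>2) t" for t
  have qubit: "g t \<in> qubit_states" if "t \<in> {0..1}" for t
    using that bloch_qubit_state by (simp add: g_def)
  have "continuous_on {0..1} g"
  proof -
    have "continuous_on {0..1} (\<lambda>t. g t $ i $ j)" for i j
      using exhaust_2[of i] exhaust_2[of j]
      by (elim disjE; simp add: g_def bloch_def; intro continuous_intros; simp)
    then have "continuous_on {0..1} (\<lambda>t. \<chi> i j. g t $ i $ j)"
      by (intro continuous_on_vec_lambda)
    then show ?thesis by simp
  qed
  then have "continuous_on {0..1} (\<lambda>t. M (g t))"
    using continuous_on_compose2[OF assms(2)] qubit by blast
  then obtain d where d: "d > 0" "\<And>t. t \<in> {0..1} \<Longrightarrow> dist t 0 < d \<Longrightarrow> dist (M (g t)) (M (g 0)) < \<epsilon>"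
    using assms(3) unfolding continuous_on_iff by (meson atLeastAtMost_iff order_refl zero_le_one)
  have M0: "M (g 0) = 0"
    using assms(1) qubit[of 0] bloch_stabilizer_states(1)[of False]
    by (auto simp: faithful_magic_measure_def g_def)
  define t where "t = min (min d 1) a / 2"
  have t: "0 < t" "t < 1" "t < a" "t < d"
    using d(1) assms(4) by (auto simp: t_def min_def)
  have "t * t < t * 1" using t by (intro mult_strict_left_mono) auto
  then have "g t \<notin> stabilizer_states"
    unfolding g_def by (intro bloch_not_stabilizer) (simp add: power2_eq_square)
  then have "0 < M (g t)"
    using assms(1) qubit[of t] t unfolding faithful_magic_measure_def
    by (metis atLeastAtMost_iff less_eq_real_def)
  moreover have "M (g t) < \<epsilon>" using d(2)[of t] t M0 by (simp add: dist_real_def)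
  ultimately show thesis using t that by (simp add: g_def)
qed

section \<open>The protocol and its strict gain\<close>

theorem theorem2:
  fixes N :: nat and x0 :: "bool list" and M :: "complex^2^2 \<Rightarrow> real" and \<epsilon> :: real
  assumes "N \<ge> 2"
    and "length x0 = N"
    and "faithful_magic_measure M"
    and "continuous_on qubit_states M"
    and "\<epsilon> > 0"
  shows "\<exists>(\<psi> :: bool list \<Rightarrow> complex^2^2) (E :: nat \<Rightarrow> bool \<Rightarrow> complex^2^2).
     \<psi> x0 \<in> qubit_states \<and> 0 < M (\<psi> x0) \<and> M (\<psi> x0) < \<epsilon> \<and>
     (\<forall>x. length x = N \<and> x \<noteq> x0 \<longrightarrow> \<psi> x \<in> stabilizer_states) \<and>
     (\<forall>y<N. stabilizer_measurement (E y)) \<and>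
     quantum_advantage N (qubit_behaviour \<psi> E)"
proof -
  obtain n where N: "N = Suc n" and n: "n \<ge> 1" using assms(1) by (cases N) auto
  \<comment> \<open>The bound \<open>1 / real n\<close> yields \<open>n * t\<^sup>2 < t\<close>, the
    gain at \<open>x0\<close>.\<close>
  obtain t where t: "0 < t" "t < 1" "t < 1 / real n"
    and M: "0 < M (bloch (1 - t\<^sup>2) t)" "M (bloch (1 - t\<^sup>2) t) < \<epsilon>"
    using magic_bloch[OF assms(3-5), of "1 / real n"] n by auto
  \<comment> \<open>The mask \<open>e\<close> turns \<open>x0\<close> into the all-plus
    word.\<close>
  define e where "e y = sgb (x0 ! y)" for y
  define a where "a x = (\<Sum>y<n. sgb (x ! Suc y) * e (Suc y))" for x
  define b where "b x = sgb (x ! 0) * e 0" for x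
  \<comment> \<open>Other words use the pole along the larger of \<open>\<bar>a x\<bar>\<close> and
    \<open>\<bar>b x\<bar> = 1\<close>, with the matching sign; ties go to the z-axis.\<close>
  define r where "r x = (if x = x0 then 1 - t\<^sup>2 else if 1 \<le> \<bar>a x\<bar> then sgb (a x < 0) else 0)" for x
  define s where "s x = (if x = x0 then t else if 1 \<le> \<bar>a x\<bar> then 0 else sgb (b x < 0))" for x
  define \<psi> where "\<psi> x = bloch (r x) (s x)" for x
  define E where "E y c = (if y = 0 then bloch 0 (sgb (c \<noteq> x0 ! y)) else bloch (sgb (c \<noteq> x0 ! y)) 0)"
    for y c
  have \<psi>0: "\<psi> x0 = bloch (1 - t\<^sup>2) t" by (simp add: \<psi>_def r_def s_def)
  have stab: "\<psi> x \<in> stabilizer_states" if "x \<noteq> x0" for x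
    using that bloch_stabilizer_states by (auto simp: \<psi>_def r_def s_def)
  have meas: "stabilizer_measurement (E y)" for y
    using bloch_stabilizer_measurement[of "x0 ! y"] by (cases "y = 0") (simp_all add: E_def[abs_def])
  have word: "(\<Sum>y<N. qubit_behaviour \<psi> E (x ! y) x y) = (N + (a x * r x + b x * s x)) / 2" for x
  proof -
    have "(\<Sum>y<N. qubit_behaviour \<psi> E (x ! y) x y)
        = (1 + b x * s x) / 2 + (\<Sum>y<n. (1 + r x * (sgb (x ! Suc y) * e (Suc y))) / 2)"
      unfolding N sum.lessThan_Suc_shift qubit_behaviour_def \<psi>_def E_def
      by (simp add: trace_bloch_mult sgb_xor b_def e_def mult_ac)
    also have "\<dots> = (N + (a x * r x + b x * s x)) / 2"
      by (simp add: N a_def sum_divide_distrib[symmetric] sum.distrib sum_distrib_left[symmetric]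
          add_divide_distrib mult_ac)
    finally show ?thesis .
  qed
  have gain: "max \<bar>a x\<bar> 1 \<le> a x * r x + b x * s x" if "x \<noteq> x0" for x
  proof -
    have "\<bar>b x\<bar> = 1" by (simp add: b_def e_def abs_mult)
    then show ?thesis using that by (auto simp: r_def s_def sgb_def max_def)
  qed
  have gain0: "max \<bar>a x0\<bar> 1 < a x0 * r x0 + b x0 * s x0"
  proof -
    have "a x0 = n" "b x0 = 1" by (simp_all add: a_def b_def e_def)
    \<comment> \<open>The value at \<open>x0\<close> is \<open>n * (1 - t\<^sup>2) + t\<close>, to
      be compared with \<open>max n 1 = n\<close>.\<close>
    moreover have "n * t * t < t" using t n by (simp add: field_simps)
    ultimately show ?thesis using n by (simp add: r_def s_def power2_eq_square algebra_simps)
  qed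
  define W where "W = (\<Sum>x\<in>words N. a x * r x + b x * s x)"
  have "x0 \<in> words N" using assms(2) by (simp add: words_def)
  \<comment> \<open>One strict term, at \<open>x0\<close>, makes the whole sum strict.\<close>
  then have "(\<Sum>x\<in>words N. max \<bar>a x\<bar> 1) < W"
    unfolding W_def using gain gain0 by (intro sum_strict_mono_ex1 finite_words) (metis less_imp_le, blast)
  moreover have "(\<Sum>x\<in>words N. max \<bar>a x\<bar> 1) = majority_sum N"
    using sum_words_max[of e n] sum_words_abs_signs[of "Suc n" e]
    by (simp add: a_def N e_def del: sum.lessThan_Suc)
  ultimately have "majority_sum N < W" by simp
  moreover have "(\<Sum>x\<in>words N. \<Sum>y<N. qubit_behaviour \<psi> E (x ! y) x y)
      = (real N * 2 ^ N + W) / 2"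
    unfolding word W_def by (simp add: sum_divide_distrib[symmetric] sum.distrib card_words)
  ultimately have "(real N * 2 ^ N + majority_sum N) / 2
      < (\<Sum>x\<in>words N. \<Sum>y<N. qubit_behaviour \<psi> E (x ! y) x y)"
    by (simp only: divide_strict_right_mono add_strict_left_mono zero_less_numeral)
  then have "(real N * 2 ^ N + majority_sum N) / 2 / (real N * 2 ^ N)
      < succ_prob N (qubit_behaviour \<psi> E)"
    unfolding succ_prob_def words_def[symmetric] using N by (intro divide_strict_right_mono) auto
  then have "quantum_advantage N (qubit_behaviour \<psi> E)"
    using classical_optimum_le[of N] by (simp only: quantum_advantage_def le_less_trans)
  moreover have "\<psi> x0 \<in> qubit_states"
    unfolding \<psi>0 using t by (intro bloch_qubit_state) auto
  ultimately show ?thesis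
    using stab meas M unfolding \<psi>0[symmetric] by blast
qed

end
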